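(* For sufficiently large $n$, $$l_{n+1}-l_n=O\left(\sqrt{l_n\log l_n}\right),$$ or equivalently $$l_{n+1}-l_n=O\left(\sqrt n\,\log n\right).$$ That is, there exist constants $C>0$ and $n_0$ such that $l_{n+1}-l_n\le C\sqrt{l_n\log l_n}$ for all integers $n\ge n_0$, and likewise there exist constants $C'>0$ and $n_0'$ such that $l_{n+1}-l_n\le C'\sqrt n\log n$ for all integers $n\ge n_0'$.
   Context: Lucky numbers: let $A_0=\mathbb N=\{1,2,3,\dots\}$. Remove every second element of $A_0$ to get $A_1=\{1,3,5,7,\dots\}$. Take the next remaining number, $3$, and remove every third element of $A_1$ (in increasing order) to get $A_2=\{1,3,7,9,13,\dots\}$. Take the next remaining number, $7$, and remove every seventh element of $A_2$ to get $A_3$, and so on. The set of lucky numbers is $A_\infty=\bigcap_i A_i=\{1,3,7,9,13,15,21,25,31,33,\dots\}$. For $n\ge2$, $l_n$ denotes the $n$th lucky number ($l_2=3$, $l_3=7$, $l_4=9,\dots$), and by convention $l_1=2$. $\log$ is the natural logarithm. *)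

theory Defs
  imports Complex_Main "HOL-Library.Infinite_Set"
begin

text \<open>The rank of \<open>x \<in> A\<close> (counted from 1) is \<open>card {y \<in> A. y \<le> x}\<close>.\<close>

definition remove_every :: "nat \<Rightarrow> nat set \<Rightarrow> nat set" where
  "remove_every s A = {x \<in> A. \<not> s dvd card {y \<in> A. y \<le> x}}"

text \<open>
  The state after \<open>i\<close> rounds is \<open>(A\<^sub>i, s)\<close>, where \<open>s\<close> is the number used in the next round.
  The sieving numbers are 2, 3, 7, 9, \<open>\<dots>\<close>: the first one is 2, although 2 is itself
  removed, and each later one is the next number remaining after its predecessor.
\<close>

primrec lucky_state :: "nat \<Rightarrow> nat set \<times> nat" where
  "lucky_state 0 = ({1..}, 2)"
| "lucky_state (Suc i) =
    (let (A, s) = lucky_state i; A' = remove_every s A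
     in (A', LEAST m. m \<in> A' \<and> s < m))"

definition lucky_sieve :: "nat \<Rightarrow> nat set" where
  "lucky_sieve i = fst (lucky_state i)"

definition lucky_numbers :: "nat set" where
  "lucky_numbers = (\<Inter>i. lucky_sieve i)"

text \<open>
  \<^const>\<open>enumerate\<close> counts from 0. By convention the first term is 2 (not the lucky number 1);
  the value at 0 is irrelevant.
\<close>

definition lucky :: "nat \<Rightarrow> nat" where
  "lucky n = (if n = 1 then 2 else enumerate lucky_numbers (n - 1))"

end

theory Submission
  imports Defs "HOL-Real_Asymp.Real_Asymp"
begin

text \<open>
  Write \<open>s\<^sub>0 = 2, s\<^sub>1 = 3, s\<^sub>2 = 7, \<dots>\<close> for the sieving numbers, so that \<open>l\<^sub>n = s\<^bsub>n-1\<^esub>\<close>, and let \<open>a\<^sub>i\<close> be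
  the rank of a lucky number \<open>s\<^sub>n\<close> in \<open>A\<^sub>i\<close>. Running the sieve backwards from \<open>a\<^sub>n = n + 1\<close> to
  \<open>a\<^sub>0 = s\<^sub>n\<close>, the rank obeys \<open>a\<^sub>i = a\<^bsub>i+1\<^esub> + \<lfloor>(a\<^bsub>i+1\<^esub> - 1) / (s\<^sub>i - 1)\<rfloor>\<close>. With
  \<open>P\<^sub>k = \<Prod>i<k. s\<^sub>i / (s\<^sub>i - 1)\<close> this gives \<open>(n + 1) P\<^sub>n / 4 \<le> s\<^sub>n \<le> (n + 1) P\<^sub>n\<close>, and since
  \<open>P\<^bsub>n+1\<^esub> - P\<^sub>n = P\<^sub>n / (s\<^sub>n - 1)\<close> is of order \<open>1 / n\<close>, \<open>P\<^sub>n\<close> is of order \<open>log n\<close>.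

  The difference \<open>d\<^sub>i\<close> of the ranks of two consecutive lucky numbers is followed backwards as well,
  starting from 1. While \<open>i \<ge> \<surd>n\<close>, it grows only when a multiple of \<open>s\<^sub>i - 1\<close> separates the two
  ranks; as \<open>s\<^sub>i\<close> decreases and the ranks increase, this happens at most once for every value of
  the quotient, so that \<open>d\<^sub>i\<close> is at most the quotient plus one, which is \<open>O(\<surd>n)\<close>. The remaining
  \<open>\<surd>n\<close> rounds multiply the difference by \<open>P = O(log n)\<close>, with a rounding error of at most \<open>1\<close> per
  round, which gives \<open>O(\<surd>n log n)\<close>.
\<close>

section \<open>Sieving numbers and ranks\<close>

definition sieve_number :: "nat \<Rightarrow> nat" where
  "sieve_number i = snd (lucky_state i)"

definition sieve_rank :: "nat \<Rightarrow> nat \<Rightarrow> nat" where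
  "sieve_rank i x = card {y \<in> lucky_sieve i. y \<le> x}"

lemma lucky_sieve_0: "lucky_sieve 0 = {1..}"
  by (simp add: lucky_sieve_def)

lemma sieve_number_0: "sieve_number 0 = 2"
  by (simp add: sieve_number_def)

lemma lucky_sieve_Suc:
  "lucky_sieve (Suc i) = remove_every (sieve_number i) (lucky_sieve i)"
  by (simp add: lucky_sieve_def sieve_number_def Let_def split: prod.split)

lemma sieve_number_Suc:
  "sieve_number (Suc i) = (LEAST m. m \<in> lucky_sieve (Suc i) \<and> sieve_number i < m)"
  by (simp add: lucky_sieve_def sieve_number_def Let_def split: prod.split)

lemma mem_lucky_sieve_Suc:
  "x \<in> lucky_sieve (Suc i) \<longleftrightarrow> x \<in> lucky_sieve i \<and> \<not> sieve_number i dvd sieve_rank i x"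
  by (simp add: lucky_sieve_Suc remove_every_def sieve_rank_def)

section \<open>Counting the survivors of one round\<close>

lemma card_le_Suc_insert:
  fixes A :: "nat set"
  shows "card {y \<in> A. y \<le> Suc x} = card {y \<in> A. y \<le> x} + (if Suc x \<in> A then 1 else 0)"
proof (cases "Suc x \<in> A")
  case True
  then have "{y \<in> A. y \<le> Suc x} = insert (Suc x) {y \<in> A. y \<le> x}"
    by auto
  with True show ?thesis by simp
next
  case False
  then have "{y \<in> A. y \<le> Suc x} = {y \<in> A. y \<le> x}"
    by (auto simp: le_Suc_eq)
  with False show ?thesis by simp
qed

text \<open>When \<open>x\<close> passes an element of \<open>A\<close>, the quotient by
  \<open>s\<close> of the count goes up exactly if the new rank is divisible by \<open>s\<close>,
  that is, if the element is removed.\<close>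

lemma card_remove_every:
  fixes A :: "nat set"
  assumes "0 \<notin> A"
  shows "card {y \<in> remove_every s A. y \<le> x} = card {y \<in> A. y \<le> x} - card {y \<in> A. y \<le> x} div s"
proof (induction x)
  case 0
  from assms have "{y \<in> A. y \<le> 0} = {}" "{y \<in> remove_every s A. y \<le> 0} = {}"
    by (auto simp: remove_every_def intro!: gr0I)
  then show ?case by (simp only: card.empty)
next
  case (Suc x)
  let ?c = "card {y \<in> A. y \<le> x}"
  have mem: "Suc x \<in> remove_every s A \<longleftrightarrow> Suc x \<in> A \<and> \<not> s dvd card {y \<in> A. y \<le> Suc x}"
    by (simp add: remove_every_def)
  have "?c div s \<le> ?c" by (rule div_le_dividend)
  then show ?case
    unfolding card_le_Suc_insert[of "remove_every s A"] mem Suc.IH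
    by (auto simp: card_le_Suc_insert div_Suc dvd_eq_mod_eq_0)
qed

text \<open>At most half of any initial segment is removed, so a segment of at least
  \<open>2 * c + 1\<close> elements leaves more than \<open>c\<close>.\<close>

lemma infinite_remove_every:
  fixes A :: "nat set"
  assumes "infinite A" "0 \<notin> A" "2 \<le> s"
  shows "infinite (remove_every s A)"
proof
  assume fin: "finite (remove_every s A)"
  define c where "c = card (remove_every s A)"
  obtain F where F: "F \<subseteq> A" "finite F" "card F = 2 * c + 1"
    using infinite_arbitrarily_large[OF assms(1)] by blast
  let ?r = "card {y \<in> A. y \<le> Max F}"
  have "F \<subseteq> {y \<in> A. y \<le> Max F}" using F by auto
  then have "card F \<le> ?r" by (intro card_mono) auto
  with F(3) have "2 * c + 1 \<le> ?r" by simp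
  moreover have "?r - ?r div s \<le> c"
    unfolding c_def card_remove_every[OF assms(2), symmetric]
    by (rule card_mono[OF fin]) auto
  moreover have "?r div s \<le> ?r div 2"
    using assms(3) by (simp add: div_le_mono2)
  ultimately show False by linarith
qed

section \<open>Ranks of the sieving numbers\<close>

lemma zero_notin_lucky_sieve: "0 \<notin> lucky_sieve i"
  by (induction i) (auto simp: lucky_sieve_0 lucky_sieve_Suc remove_every_def)

lemma sieve_rank_Suc:
  "sieve_rank (Suc i) x = sieve_rank i x - sieve_rank i x div sieve_number i"
  by (simp add: sieve_rank_def lucky_sieve_Suc card_remove_every zero_notin_lucky_sieve)

lemma sieve_rank_0: "sieve_rank 0 x = x"
proof -
  have "{y \<in> {1..}. y \<le> x} = {1..x}" by auto
  then show ?thesis by (simp add: sieve_rank_def lucky_sieve_0)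
qed

text \<open>The two claims support each other: a sieving number of at least 2 keeps the next set
  infinite, and infinitude makes the next \<open>LEAST\<close> exist.\<close>

lemma infinite_lucky_sieve_and_sieve_number_ge:
  "infinite (lucky_sieve i) \<and> i + 2 \<le> sieve_number i"
proof (induction i)
  case 0
  then show ?case by (simp add: lucky_sieve_0 sieve_number_0 infinite_Ici)
next
  case (Suc i)
  then have inf: "infinite (lucky_sieve (Suc i))"
    by (simp add: lucky_sieve_Suc infinite_remove_every zero_notin_lucky_sieve)
  then obtain m where "m \<in> lucky_sieve (Suc i) \<and> sieve_number i < m"
    unfolding infinite_nat_iff_unbounded by blast
  then have "sieve_number i < sieve_number (Suc i)"
    unfolding sieve_number_Suc by (rule LeastI2) simp
  with Suc inf show ?case by simp
qed

lemma sieve_number_ge: "i + 2 \<le> sieve_number i"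
  using infinite_lucky_sieve_and_sieve_number_ge by blast

lemma sieve_number_Suc_mem_and_greater:
  "sieve_number (Suc i) \<in> lucky_sieve (Suc i) \<and> sieve_number i < sieve_number (Suc i)"
proof -
  obtain m where "m \<in> lucky_sieve (Suc i) \<and> sieve_number i < m"
    using infinite_lucky_sieve_and_sieve_number_ge infinite_nat_iff_unbounded by blast
  then show ?thesis unfolding sieve_number_Suc by (rule LeastI)
qed

lemma strict_mono_sieve_number: "strict_mono sieve_number"
  using sieve_number_Suc_mem_and_greater by (simp add: strict_mono_Suc_iff)

lemma sieve_number_mono: "i \<le> j \<Longrightarrow> sieve_number i \<le> sieve_number j"
  using strict_mono_sieve_number by (simp add: strict_mono_less_eq)

lemma sieve_rank_sieve_number_Suc:
  "sieve_rank (Suc i) (sieve_number (Suc i)) = Suc (sieve_rank (Suc i) (sieve_number i))"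
proof -
  let ?A = "lucky_sieve (Suc i)" and ?s = "sieve_number i" and ?t = "sieve_number (Suc i)"
  have t: "?t \<in> ?A" "?s < ?t"
    using sieve_number_Suc_mem_and_greater by auto
  have "y \<le> ?s" if "y \<in> ?A" "y < ?t" for y
    using that not_less_Least[of y "\<lambda>m. m \<in> ?A \<and> ?s < m"] by (auto simp: sieve_number_Suc)
  with t have "{y \<in> ?A. y \<le> ?t} = insert ?t {y \<in> ?A. y \<le> ?s}"
    by force
  with t show ?thesis by (simp add: sieve_rank_def)
qed

text \<open>Round \<open>Suc i\<close> removes nothing up to \<open>sieve_number (Suc i)\<close>,
  whose rank \<open>i + 2\<close> is still below it. Measuring after the round makes
  \<open>i = 0\<close> fit: 2 is gone and only 1 is counted.\<close>

lemma sieve_rank_Suc_self: "sieve_rank (Suc i) (sieve_number i) = Suc i"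
proof (induction i)
  case 0
  then show ?case by (simp add: sieve_rank_Suc sieve_rank_0 sieve_number_0)
next
  case (Suc i)
  then have "sieve_rank (Suc i) (sieve_number (Suc i)) = i + 2"
    by (simp add: sieve_rank_sieve_number_Suc)
  then show ?case
    using sieve_number_ge[of "Suc i"] by (simp add: sieve_rank_Suc[of "Suc i"])
qed

text \<open>The rank \<open>i + 1\<close> is below \<open>sieve_number k\<close> for all
  \<open>k \<ge> i\<close>, so these rounds change nothing up to
  \<open>sieve_number i\<close>.\<close>

lemma sieve_number_stable:
  assumes "1 \<le> i" "i \<le> k"
  shows "sieve_number i \<in> lucky_sieve k \<and> sieve_rank k (sieve_number i) = i + 1"
  using assms(2)
proof (induction k rule: dec_induct)
  case base
  obtain j where "i = Suc j" using assms(1) by (cases i) auto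
  then show ?case
    using sieve_number_Suc_mem_and_greater sieve_rank_sieve_number_Suc sieve_rank_Suc_self by simp
next
  case (step k)
  have "i + 1 < sieve_number k"
    using sieve_number_ge[of k] step.hyps by linarith
  with step.IH show ?case
    by (simp add: mem_lucky_sieve_Suc sieve_rank_Suc nat_dvd_not_less)
qed

lemma lucky_sieve_antimono: "i \<le> k \<Longrightarrow> lucky_sieve k \<subseteq> lucky_sieve i"
  by (rule lift_Suc_antimono_le) (auto simp: mem_lucky_sieve_Suc)

lemma sieve_number_mem_lucky_sieve: "1 \<le> i \<Longrightarrow> sieve_number i \<in> lucky_sieve k"
  using sieve_number_stable[of i "max i k"] lucky_sieve_antimono[of k "max i k"] by auto

lemma one_mem_lucky_sieve: "1 \<in> lucky_sieve k \<and> sieve_rank k 1 = 1"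
proof (induction k)
  case 0
  show ?case by (simp add: lucky_sieve_0 sieve_rank_0)
next
  case (Suc k)
  then show ?case
    using sieve_number_ge[of k] by (simp add: mem_lucky_sieve_Suc sieve_rank_Suc)
qed

section \<open>Lucky numbers as the sequence of sieving numbers\<close>

lemma lucky_numbers_eq: "lucky_numbers = insert 1 (sieve_number ` {1..})"
proof
  show "insert 1 (sieve_number ` {1..}) \<subseteq> lucky_numbers"
    using one_mem_lucky_sieve sieve_number_mem_lucky_sieve by (auto simp: lucky_numbers_def)
  show "lucky_numbers \<subseteq> insert 1 (sieve_number ` {1..})"
  proof
    fix x assume x: "x \<in> lucky_numbers"
    then have x_mem: "x \<in> lucky_sieve i" for i by (auto simp: lucky_numbers_def)
    show "x \<in> insert 1 (sieve_number ` {1..})"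
    proof (cases "x \<le> 2")
      case True
      have "\<not> 2 dvd x"
        using x_mem[of "Suc 0"] by (simp add: mem_lucky_sieve_Suc sieve_rank_0 sieve_number_0)
      with True have "x = 1" by (cases "x = 0"; cases "x = 2") auto
      then show ?thesis by simp
    next
      case False
      \<comment> \<open>By minimality of \<open>k\<close>, \<open>x\<close> exceeds the preceding
        sieving number; having survived, it competes in the \<open>LEAST\<close> that defines
        \<open>sieve_number k\<close>.\<close>
      define k where "k = (LEAST k. x \<le> sieve_number k)"
      have ex: "x \<le> sieve_number x" using sieve_number_ge[of x] by linarith
      have k: "x \<le> sieve_number k" unfolding k_def using ex by (rule LeastI)
      with False have "k \<noteq> 0" by (metis sieve_number_0)
      then obtain j where j: "k = Suc j" by (cases k) auto
      then have "sieve_number j < x"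
        using not_less_Least[of j "\<lambda>k. x \<le> sieve_number k"] by (simp add: k_def not_le)
      then have "sieve_number k \<le> x"
        unfolding j sieve_number_Suc using x_mem by (intro Least_le) auto
      with k j show ?thesis by auto
    qed
  qed
qed

lemma strict_mono_imp_enumerate_range:
  fixes f :: "nat \<Rightarrow> nat"
  assumes "strict_mono f"
  shows "enumerate (range f) n = f n"
proof (induction n)
  case 0
  have "(LEAST m. m \<in> range f) = f 0"
    using assms by (intro Least_equality) (auto simp: strict_mono_less_eq)
  then show ?case by (simp add: enumerate_0)
next
  case (Suc n)
  have "infinite (range f)"
    using assms by (simp add: range_inj_infinite strict_mono_imp_inj_on)
  moreover have "(LEAST m. m \<in> range f \<and> f n < m) = f (Suc n)"
    using assms by (intro Least_equality) (auto simp: strict_mono_less strict_mono_less_eq)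
  ultimately show ?case by (simp add: enumerate_Suc'' Suc.IH)
qed

lemma lucky_eq_sieve_number:
  assumes "1 \<le> n"
  shows "lucky n = sieve_number (n - 1)"
proof (cases "n = 1")
  case True
  then show ?thesis by (simp add: lucky_def sieve_number_0)
next
  case False
  \<comment> \<open>\<open>enumerate\<close> starts with the lucky number 1, whereas
    \<open>sieve_number 0\<close> is 2; from index 1 on the sequences agree.\<close>
  define u where "u = (\<lambda>i. if i = 0 then 1 else sieve_number i)"
  have "u i < u (Suc i)" for i
    using sieve_number_ge[of "Suc i"] strict_mono_sieve_number by (auto simp: u_def strict_mono_less)
  then have "strict_mono u" by (simp add: strict_mono_Suc_iff)
  moreover have "range u = lucky_numbers"
    unfolding lucky_numbers_eq by (auto simp: u_def image_iff)
  ultimately have "enumerate lucky_numbers (n - 1) = u (n - 1)"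
    using strict_mono_imp_enumerate_range by metis
  with False assms show ?thesis by (simp add: lucky_def u_def)
qed

section \<open>Ranks traced backwards and the sieve product\<close>

text \<open>A survivor has rank \<open>q * s + t\<close> with \<open>0 < t < s\<close>. Its new rank
  is \<open>q * (s - 1) + t\<close>, and subtracting 1 brings the remainder below
  \<open>s - 1\<close>, so the quotient recovers \<open>q\<close>.\<close>

lemma sieve_rank_backward:
  assumes "x \<in> lucky_sieve (Suc i)"
  shows "sieve_rank i x = sieve_rank (Suc i) x + (sieve_rank (Suc i) x - 1) div (sieve_number i - 1)"
proof -
  define r s where "r = sieve_rank i x" and "s = sieve_number i"
  have s: "2 \<le> s" using sieve_number_ge[of i] by (simp add: s_def)
  define q t where "q = r div s" and "t = r mod s"
  have "0 < t" using assms by (simp add: mem_lucky_sieve_Suc t_def r_def s_def dvd_eq_mod_eq_0)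
  have "t < s" using s by (simp add: t_def)
  have r: "r = q * s + t" by (simp add: q_def t_def)
  obtain s' t' where st: "s = Suc s'" "t = Suc t'"
    using s \<open>0 < t\<close> by (metis Suc_pred less_le_trans zero_less_numeral)
  have "r - q = q * s' + t" by (simp add: r st)
  moreover have "(q * s' + t - 1) div s' = q"
    using \<open>t < s\<close> by (simp add: st)
  ultimately show ?thesis
    by (simp add: sieve_rank_Suc flip: r_def s_def q_def) (simp add: r st)
qed

text \<open>The reciprocal of the density of \<open>lucky_sieve k\<close>: each round keeps the
  proportion \<open>1 - 1 / s\<close>.\<close>

definition sieve_product :: "nat \<Rightarrow> real" where
  "sieve_product k = (\<Prod>i<k. real (sieve_number i) / (real (sieve_number i) - 1))"

lemma sieve_product_0: "sieve_product 0 = 1"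
  by (simp add: sieve_product_def)

lemma sieve_product_Suc:
  "sieve_product (Suc k) = sieve_product k * (1 + 1 / (real (sieve_number k) - 1))"
proof -
  have "real (sieve_number k) / (real (sieve_number k) - 1) = 1 + 1 / (real (sieve_number k) - 1)"
    using sieve_number_ge[of k] by (simp add: field_simps)
  then show ?thesis by (simp add: sieve_product_def)
qed

lemma sieve_product_mono: "i \<le> j \<Longrightarrow> sieve_product i \<le> sieve_product j"
  and sieve_product_ge_1: "1 \<le> sieve_product k"
proof -
  show *: "1 \<le> sieve_product k" for k
  proof (induction k)
    case (Suc k)
    have "1 * 1 \<le> sieve_product k * (1 + 1 / (real (sieve_number k) - 1))"
      using Suc sieve_number_ge[of k] by (intro mult_mono) auto
    then show ?case by (simp add: sieve_product_Suc)
  qed (simp add: sieve_product_0)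
  have "sieve_product k \<le> sieve_product (Suc k)" for k
    using *[of k] sieve_number_ge[of k] by (simp add: sieve_product_Suc distrib_left)
  then show "i \<le> j \<Longrightarrow> sieve_product i \<le> sieve_product j"
    by (rule lift_Suc_mono_le)
qed

text \<open>\<open>(a - 1) div g\<close> is the ceiling of \<open>a / g\<close>, minus 1.\<close>

lemma real_div_bounds:
  fixes a g :: nat
  assumes "1 \<le> a" "0 < g"
  shows "real ((a - 1) div g) \<le> real a / real g" "real a / real g - 1 \<le> real ((a - 1) div g)"
proof -
  have "(a - 1) div g * g \<le> a" using div_times_less_eq_dividend[of "a - 1" g] by linarith
  then have "real ((a - 1) div g) * real g \<le> real a" by (metis of_nat_le_iff of_nat_mult)
  then show "real ((a - 1) div g) \<le> real a / real g" using assms(2) by (simp add: field_simps)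
  have "a \<le> (a - 1) div g * g + g"
    using div_mult_mod_eq[of "a - 1" g] mod_less_divisor[OF assms(2), of "a - 1"] assms(1) by linarith
  then have "real a \<le> real ((a - 1) div g) * real g + real g"
    by (metis of_nat_le_iff of_nat_mult of_nat_add)
  then show "real a / real g - 1 \<le> real ((a - 1) div g)" using assms(2) by (simp add: field_simps)
qed

lemma real_sieve_number_minus_1: "real (sieve_number i - 1) = real (sieve_number i) - 1"
  using sieve_number_ge[of i] by (simp add: of_nat_diff)

lemma sieve_rank_antimono: "i \<le> k \<Longrightarrow> sieve_rank k x \<le> sieve_rank i x"
  by (rule lift_Suc_antimono_le[of "\<lambda>i. sieve_rank i x"]) (auto simp: sieve_rank_Suc)

lemma sieve_rank_sieve_number_ge:
  assumes "1 \<le> n"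
  shows "n + 1 \<le> sieve_rank i (sieve_number n)"
  using sieve_number_stable[of n "max i n"] assms
    sieve_rank_antimono[of i "max i n" "sieve_number n"] by simp

lemma sieve_rank_sieve_number_backward:
  assumes "1 \<le> n"
  shows "sieve_rank i (sieve_number n) =
    sieve_rank (Suc i) (sieve_number n) + (sieve_rank (Suc i) (sieve_number n) - 1) div (sieve_number i - 1)"
  using assms by (intro sieve_rank_backward sieve_number_mem_lucky_sieve)

lemma sieve_rank_sieve_number_backward_bounds:
  fixes n i
  defines "a \<equiv> \<lambda>i. real (sieve_rank i (sieve_number n))"
  assumes "1 \<le> n"
  shows "a i \<le> a (Suc i) * (1 + 1 / (real (sieve_number i) - 1))"
    and "a (Suc i) * (1 + 1 / (real (sieve_number i) - 1)) - 1 \<le> a i"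
  using real_div_bounds[of "sieve_rank (Suc i) (sieve_number n)" "sieve_number i - 1"]
    sieve_rank_sieve_number_ge[OF assms(2), of "Suc i"] sieve_number_ge[of i]
  unfolding a_def sieve_rank_sieve_number_backward[OF assms(2), of i]
  by (simp_all add: distrib_left real_sieve_number_minus_1)

text \<open>Rounding down only helps here: rank times product is nondecreasing in \<open>i\<close>,
  and at \<open>i = n\<close> the rank is \<open>n + 1\<close>.\<close>

lemma sieve_rank_mult_sieve_product_le:
  assumes "1 \<le> n" "i \<le> n"
  shows "real (sieve_rank i (sieve_number n)) * sieve_product i \<le> (real n + 1) * sieve_product n"
  using assms(2)
proof (induction i rule: inc_induct)
  case base
  show ?case using sieve_number_stable[of n n] assms(1) by (simp add: add.commute)
next
  case (step i)
  have "real (sieve_rank i (sieve_number n)) * sieve_product i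
      \<le> real (sieve_rank (Suc i) (sieve_number n)) * (1 + 1 / (real (sieve_number i) - 1)) * sieve_product i"
    using sieve_rank_sieve_number_backward_bounds(1)[OF assms(1)] sieve_product_ge_1[of i]
    by (intro mult_right_mono) auto
  also have "\<dots> = real (sieve_rank (Suc i) (sieve_number n)) * sieve_product (Suc i)"
    by (simp add: sieve_product_Suc mult_ac)
  finally show ?case using step.IH by simp
qed

lemma sieve_number_le:
  assumes "1 \<le> n"
  shows "real (sieve_number n) \<le> (real n + 1) * sieve_product n"
  using sieve_rank_mult_sieve_product_le[OF assms, of 0] by (simp add: sieve_rank_0 sieve_product_0)

text \<open>Each backward round loses at most 1 to rounding, so the left side is nonincreasing in
  \<open>i\<close>. At \<open>i = n\<close> only \<open>sieve_product n\<close> would remain; the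
  useful choice is \<open>i\<close> near \<open>n / 2\<close>.\<close>

lemma sieve_number_ge_sieve_product_mult:
  assumes "1 \<le> n"
  shows "sieve_product i * (real (sieve_rank i (sieve_number n)) - real i) \<le> real (sieve_number n)"
proof (induction i)
  case 0
  show ?case by (simp add: sieve_rank_0 sieve_product_0)
next
  case (Suc i)
  let ?a = "\<lambda>i. real (sieve_rank i (sieve_number n))"
  have "sieve_product i \<le> sieve_product (Suc i)" by (rule sieve_product_mono) simp
  then have "sieve_product i * (real i + 1) \<le> sieve_product (Suc i) * (real i + 1)"
    by (intro mult_right_mono) auto
  then have "sieve_product (Suc i) * (?a (Suc i) - real (Suc i))
      \<le> sieve_product (Suc i) * ?a (Suc i) - sieve_product i * (real i + 1)"
    by (simp add: algebra_simps)
  also have "\<dots> = sieve_product i * (?a (Suc i) * (1 + 1 / (real (sieve_number i) - 1)) - 1 - real i)"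
    by (simp add: sieve_product_Suc algebra_simps)
  also have "\<dots> \<le> sieve_product i * (?a i - real i)"
    using sieve_rank_sieve_number_backward_bounds(2)[OF assms, of i] sieve_product_ge_1[of i]
    by (intro mult_left_mono) auto
  finally show ?case using Suc.IH by linarith
qed

text \<open>Each factor is at most \<open>(k + 2) / (k + 1)\<close>, and these telescope.\<close>

lemma sieve_product_ratio_le:
  assumes "m \<le> n"
  shows "sieve_product n * (real m + 1) \<le> sieve_product m * (real n + 1)"
  using assms
proof (induction n rule: dec_induct)
  case (step n)
  have "1 / (real (sieve_number n) - 1) \<le> 1 / (real n + 1)"
    using sieve_number_ge[of n] by (intro divide_left_mono) auto
  then have "sieve_product (Suc n) * (real m + 1)
      \<le> sieve_product n * (1 + 1 / (real n + 1)) * (real m + 1)"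
    using sieve_product_ge_1[of n] unfolding sieve_product_Suc
    by (intro mult_right_mono mult_left_mono) auto
  also have "\<dots> = (sieve_product n * (real m + 1)) * (1 + 1 / (real n + 1))"
    by (simp add: mult_ac)
  also have "\<dots> \<le> (sieve_product m * (real n + 1)) * (1 + 1 / (real n + 1))"
    by (intro mult_right_mono step.IH) auto
  also have "\<dots> = sieve_product m * (real (Suc n) + 1)"
    by (simp add: field_simps)
  finally show ?case .
qed simp

lemma sieve_number_ge_sieve_product:
  assumes "1 \<le> n"
  shows "(real n + 1) * sieve_product n / 4 \<le> real (sieve_number n)"
proof -
  \<comment> \<open>Halfway, the product has lost at most a factor 2 against
    \<open>sieve_product n\<close>, and rank minus \<open>m\<close> is at least
    \<open>(n + 1) / 2\<close>; hence the 4.\<close>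
  define m where "m = n div 2"
  have m: "m \<le> n" "real n + 1 \<le> 2 * (real m + 1)" "real n + 1 \<le> 2 * (real n + 1 - real m)"
    by (auto simp: m_def)
  have "sieve_product n * (real m + 1) \<le> sieve_product m * (2 * (real m + 1))"
    using sieve_product_ratio_le[OF m(1)] m(2) sieve_product_ge_1[of m]
    by (meson mult_left_mono order_trans zero_le_one)
  then have "sieve_product n * (real m + 1) \<le> 2 * sieve_product m * (real m + 1)"
    by (simp only: mult_ac)
  then have "sieve_product n \<le> 2 * sieve_product m"
    by (rule mult_right_le_imp_le) simp
  then have "(real n + 1) * sieve_product n \<le> (real n + 1) * (2 * sieve_product m)"
    by (intro mult_left_mono) auto
  then have "(real n + 1) * sieve_product n / 4 \<le> sieve_product m * ((real n + 1) / 2)"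
    by (simp add: algebra_simps)
  also have "\<dots> \<le> sieve_product m * (real (sieve_rank m (sieve_number n)) - real m)"
    using m(3) sieve_rank_sieve_number_ge[OF assms, of m] sieve_product_ge_1[of m]
    by (intro mult_left_mono) auto
  also have "\<dots> \<le> real (sieve_number n)" by (rule sieve_number_ge_sieve_product_mult[OF assms])
  finally show ?thesis .
qed

lemma sieve_number_minus_1_ge: "(real n + 1) * sieve_product n / 8 \<le> real (sieve_number n) - 1"
proof (cases "n = 0")
  case True
  then show ?thesis by (simp add: sieve_product_0 sieve_number_0)
next
  case False
  then show ?thesis
    using sieve_number_ge_sieve_product[of n] sieve_number_ge[of n] by simp
qed

section \<open>Logarithmic growth of the product\<close>

text \<open>The increment is \<open>sieve_product n / (s - 1)\<close> with \<open>s - 1\<close> at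
  most \<open>(n + 1) * sieve_product n\<close>, so the unknown product cancels.\<close>

lemma sieve_product_increment_ge: "sieve_product n + 1 / (real n + 1) \<le> sieve_product (Suc n)"
proof -
  have "real (sieve_number n) - 1 \<le> (real n + 1) * sieve_product n"
    using sieve_number_le[of n] by (cases "n = 0") (auto simp: sieve_product_0 sieve_number_0)
  then have "1 / (real n + 1) \<le> sieve_product n / (real (sieve_number n) - 1)"
    using sieve_number_ge[of n] by (simp add: field_simps)
  then show ?thesis by (simp add: sieve_product_Suc distrib_left)
qed

lemma sieve_product_increment_le: "sieve_product (Suc n) \<le> sieve_product n + 8 / (real n + 1)"
proof -
  have "sieve_product n / (real (sieve_number n) - 1) \<le> 8 / (real n + 1)"
    using sieve_number_minus_1_ge[of n] sieve_number_ge[of n] by (simp add: field_simps)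
  then show ?thesis by (simp add: sieve_product_Suc distrib_left)
qed

lemma ln_le_sieve_product: "ln (real n + 1) \<le> sieve_product n"
proof (induction n)
  case (Suc n)
  have "ln (real n + 2) - ln (real n + 1) \<le> 1 / (real n + 1)"
    using ln_diff_le[of "real n + 2" "real n + 1"] by simp
  then show ?case using Suc sieve_product_increment_ge[of n] by (simp add: add_ac)
qed (simp add: sieve_product_0)

text \<open>Starting from \<open>sieve_product 1 = 2\<close>, the increments
  \<open>8 / (k + 1)\<close> with \<open>k \<ge> 1\<close> stay below those of
  \<open>8 * ln (k + 1)\<close>.\<close>

lemma sieve_product_le_ln: "sieve_product (Suc n) \<le> 2 + 8 * ln (real n + 1)"
proof (induction n)
  case 0
  show ?case by (simp add: sieve_product_Suc sieve_product_0 sieve_number_0)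
next
  case (Suc n)
  have "ln (real n + 1) - ln (real n + 2) \<le> - 1 / (real n + 2)"
    using ln_diff_le[of "real n + 1" "real n + 2"] by simp
  then show ?case using Suc sieve_product_increment_le[of "Suc n"] by (simp add: add_ac)
qed

section \<open>Gaps traced backwards\<close>

text \<open>A backward round multiplies the difference by its factor and adds at most 1, so the
  right side is nondecreasing in \<open>i\<close>; at \<open>i = 0\<close> it is the gap itself.
  This serves the first rounds of the sieve.\<close>

lemma sieve_number_gap_le:
  fixes n i
  defines "d \<equiv> \<lambda>i. real (sieve_rank i (sieve_number (Suc n))) - real (sieve_rank i (sieve_number n))"
  assumes "1 \<le> n"
  shows "real (sieve_number (Suc n)) - real (sieve_number n) \<le> sieve_product i * (d i + real i)"
proof (induction i)
  case 0
  show ?case by (simp add: d_def sieve_rank_0 sieve_product_0)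
next
  case (Suc i)
  have "d i \<le> d (Suc i) * (1 + 1 / (real (sieve_number i) - 1)) + 1"
    using sieve_rank_sieve_number_backward_bounds(1)[of "Suc n" i]
      sieve_rank_sieve_number_backward_bounds(2)[OF assms(2), of i]
    unfolding d_def left_diff_distrib by linarith
  then have "sieve_product i * (d i + real i)
      \<le> sieve_product i * (d (Suc i) * (1 + 1 / (real (sieve_number i) - 1)) + 1 + real i)"
    using sieve_product_ge_1[of i] by (intro mult_left_mono) auto
  also have "\<dots> = sieve_product (Suc i) * d (Suc i) + sieve_product i * (1 + real i)"
    by (simp add: sieve_product_Suc algebra_simps)
  also have "\<dots> \<le> sieve_product (Suc i) * d (Suc i) + sieve_product (Suc i) * (1 + real i)"
    by (intro add_left_mono mult_right_mono sieve_product_mono) auto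
  finally show ?case using Suc.IH by (simp add: algebra_simps)
qed

text \<open>
  Here \<open>a \<le> b\<close> are the ranks of two consecutive lucky numbers and \<open>g\<close> is the sieving number
  minus 1. The second alternative describes the rounds after the one in which the multiple
  \<open>((b - 1) div g) * g\<close> has separated the ranks; the remainder is then so large that this
  cannot happen again for the same quotient.
\<close>

definition gap_controlled :: "nat \<Rightarrow> nat \<Rightarrow> nat \<Rightarrow> bool" where
  "gap_controlled a b g \<longleftrightarrow> b \<le> a + (b - 1) div g \<or>
     b \<le> a + (b - 1) div g + 1 \<and> 2 * ((b - 1) div g) \<le> (b - 1) mod g"

text \<open>Let \<open>j\<close> be the old quotient of \<open>b - 1\<close>. In the first
  alternative that of \<open>a - 1\<close> is at least \<open>j - 1\<close>, so the difference grows
  by at most 1; in the second the quotients agree and it does not grow. Either way it ends at most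
  \<open>j + 1\<close>, which suffices if the quotient rises; otherwise the remainder has become
  large.\<close>

lemma gap_controlled_step:
  fixes a b g g' :: nat
  assumes "gap_controlled a b g" "1 \<le> a" "a \<le> b" "0 < g'" "g' < g" "(b - 1) div g + 1 \<le> g"
  shows "gap_controlled (a + (a - 1) div g) (b + (b - 1) div g) g'"
proof -
  define j t where "j = (b - 1) div g" and "t = (b - 1) mod g"
  define b' where "b' = b + j"
  define j' t' where "j' = (b' - 1) div g'" and "t' = (b' - 1) mod g'"
  have b: "b - 1 = j * g + t" by (simp add: j_def t_def)
  have b'1: "b' - 1 = j' * g' + t'" by (simp add: j'_def t'_def)
  have b'2: "b' - 1 = j * g + t + j" using b assms(2,3) by (simp add: b'_def)
  have inv: "b \<le> a + j \<or> b \<le> a + j + 1 \<and> 2 * j \<le> t"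
    using assms(1) by (simp add: gap_controlled_def j_def t_def)
  have gap: "b' \<le> a + (a - 1) div g + j + 1"
  proof (cases "j = 0")
    case True
    with inv show ?thesis unfolding b'_def by linarith
  next
    case False
    from inv show ?thesis
    proof
      assume "b \<le> a + j"
      have "(j - 1) * g + g = j * g" using False by (cases j) auto
      then have "(j - 1) * g \<le> a - 1"
        using b \<open>b \<le> a + j\<close> assms(6) unfolding j_def[symmetric] by linarith
      then have "j - 1 \<le> (a - 1) div g"
        using assms(5) by (simp add: less_eq_div_iff_mult_less_eq)
      with \<open>b \<le> a + j\<close> show ?thesis by (simp add: b'_def)
    next
      assume *: "b \<le> a + j + 1 \<and> 2 * j \<le> t"
      then have "j * g \<le> a - 1" using b False by linarith
      then have "j \<le> (a - 1) div g"
        using assms(5) by (simp add: less_eq_div_iff_mult_less_eq)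
      with * show ?thesis by (simp add: b'_def)
    qed
  qed
  \<comment> \<open>Lowering \<open>g\<close> by at least 1 frees \<open>j\<close> units of
    remainder; with the \<open>j\<close> added to \<open>b\<close> this yields the
    \<open>2 * j\<close> of the second alternative.\<close>
  have jg: "j * g' + j \<le> j * g"
    using mult_le_mono2[of "Suc g'" g j] assms(5) by simp
  then have "j * g' \<le> b' - 1" using b'2 by linarith
  then have "j \<le> j'" unfolding j'_def using assms(4) by (simp add: less_eq_div_iff_mult_less_eq)
  then consider "j + 1 \<le> j'" | "j' = j" by linarith
  then have "b' \<le> a + (a - 1) div g + j' \<or> b' \<le> a + (a - 1) div g + j' + 1 \<and> 2 * j' \<le> t'"
  proof cases
    case 1
    with gap show ?thesis by linarith
  next
    case 2
    from b'1 b'2 jg have "2 * j \<le> t'" unfolding 2 by linarith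
    then have "2 * j' \<le> t'" by (simp add: 2)
    with gap 2 show ?thesis by simp
  qed
  then show ?thesis
    unfolding gap_controlled_def j_def[symmetric] b'_def[symmetric] j'_def[symmetric] t'_def[symmetric] .
qed

text \<open>The step lemma is iterated from \<open>Suc n\<close> down to \<open>m\<close>. With
  growing index ranks shrink and sieving numbers grow, so \<open>small\<close> at \<open>m\<close>
  yields its side condition in every round.\<close>

lemma gap_controlled_sieve_rank:
  fixes n m
  defines "a \<equiv> \<lambda>i. sieve_rank i (sieve_number n)"
  defines "b \<equiv> \<lambda>i. sieve_rank i (sieve_number (Suc n))"
  assumes "1 \<le> n" "m \<le> Suc n"
  assumes small: "(b (Suc m) - 1) div (sieve_number m - 1) + 1 \<le> sieve_number m - 1"
  shows "gap_controlled (a (Suc m)) (b (Suc m)) (sieve_number m - 1)"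
proof -
  have "gap_controlled (a (Suc i)) (b (Suc i)) (sieve_number i - 1)" if "m \<le> i" "i \<le> Suc n" for i
    using that(2,1)
  proof (induction i rule: inc_induct)
    case base
    \<comment> \<open>Here the quotient is 0 and the difference 1: the second alternative
      holds.\<close>
    have "a (Suc (Suc n)) = n + 1" "b (Suc (Suc n)) = n + 2"
      using sieve_number_stable[of n "Suc (Suc n)"] sieve_number_stable[of "Suc n" "Suc (Suc n)"] assms(3)
      by (auto simp: a_def b_def)
    then show ?case
      using sieve_number_ge[of "Suc n"] by (simp add: gap_controlled_def)
  next
    case (step i)
    have ab: "a i \<le> b i" for i
      unfolding a_def b_def sieve_rank_def
      using sieve_number_mono[of n "Suc n"] by (intro card_mono) auto
    have "sieve_number i < sieve_number (Suc i)"
      using strict_mono_sieve_number by (simp add: strict_mono_less)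
    then have g: "0 < sieve_number i - 1" "sieve_number i - 1 < sieve_number (Suc i) - 1"
      using sieve_number_ge[of i] by linarith+
    have "sieve_number m \<le> sieve_number (Suc i)"
      using step.prems by (intro sieve_number_mono) simp
    moreover have "b (Suc (Suc i)) \<le> b (Suc m)"
      unfolding b_def using step.prems by (intro sieve_rank_antimono) simp
    ultimately have "(b (Suc (Suc i)) - 1) div (sieve_number (Suc i) - 1)
        \<le> (b (Suc m) - 1) div (sieve_number m - 1)"
      using sieve_number_ge[of m]
      by (intro order_trans[OF div_le_mono div_le_mono2]) auto
    with small \<open>sieve_number m \<le> sieve_number (Suc i)\<close>
    have "(b (Suc (Suc i)) - 1) div (sieve_number (Suc i) - 1) + 1 \<le> sieve_number (Suc i) - 1"
      by linarith
    moreover have "1 \<le> a (Suc (Suc i))"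
      using sieve_rank_sieve_number_ge[OF assms(3), of "Suc (Suc i)"] by (simp add: a_def)
    ultimately have "gap_controlled
        (a (Suc (Suc i)) + (a (Suc (Suc i)) - 1) div (sieve_number (Suc i) - 1))
        (b (Suc (Suc i)) + (b (Suc (Suc i)) - 1) div (sieve_number (Suc i) - 1)) (sieve_number i - 1)"
      using step.IH step.prems ab g by (intro gap_controlled_step) auto
    then show ?case
      unfolding a_def b_def using sieve_rank_sieve_number_backward[of _ "Suc i"] assms(3) by simp
  qed
  with assms(4) show ?thesis by simp
qed

section \<open>Asymptotic bounds\<close>

lemma sieve_number_gap_eventually:
  "eventually (\<lambda>n. real (sieve_number (Suc n)) - real (sieve_number n) \<le> 20 * (sqrt (real n) * ln (real n)))
     sequentially"
proof -
  \<comment> \<open>This will give \<open>j \<le> sqrt n - 1\<close>; 32 is 16 from the lower bound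
    on \<open>g\<close> times 2 from the one on \<open>sieve_product m\<close>.\<close>
  have "eventually (\<lambda>n::nat. 32 * (real n + 2) * (2 + 8 * ln (real n + 1))
      \<le> (sqrt (real n) - 1) * (sqrt (real n) * (ln (real n))\<^sup>2)) sequentially"
    by real_asymp
  \<comment> \<open>The leading constant on the left is \<open>8 * 2 = 16\<close>, so 20 leaves
    room.\<close>
  moreover have "eventually (\<lambda>n::nat. (2 + 8 * ln (real n + 1)) * (2 * sqrt (real n) + 1)
      \<le> 20 * (sqrt (real n) * ln (real n))) sequentially"
    by real_asymp
  ultimately show ?thesis
    using eventually_ge_at_top[of 2]
  proof eventually_elim
    case (elim n)
    define m where "m = nat \<lfloor>sqrt (real n)\<rfloor>"
    have m: "real m \<le> sqrt (real n)" "sqrt (real n) < real m + 1"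
      by (auto simp: m_def)
    have "sqrt (real n) \<le> real n" using elim(3) by (simp add: real_le_lsqrt power2_eq_square)
    with m have "m \<le> n" by linarith
    define b where "b = sieve_rank (Suc m) (sieve_number (Suc n))"
    define g where "g = sieve_number m - 1"
    define j where "j = (b - 1) div g"
    have g: "m + 1 \<le> g" "0 < g" using sieve_number_ge[of m] by (auto simp: g_def)
    have b: "1 \<le> b" using sieve_rank_sieve_number_ge[of "Suc n" "Suc m"] by (simp add: b_def)
    have "ln (real n) / 2 = ln (sqrt (real n))" using elim(3) by (simp add: ln_sqrt)
    also have "\<dots> \<le> ln (real m + 1)" using m elim(3) by (intro ln_mono) auto
    also have "\<dots> \<le> sieve_product m" by (rule ln_le_sieve_product)
    finally have Pm: "ln (real n) / 2 \<le> sieve_product m" .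
    have ln_pos: "0 < ln (real n)" using elim(3) by simp
    have Pn: "sieve_product (Suc n) \<le> 2 + 8 * ln (real n + 1)" by (rule sieve_product_le_ln)
    have "sqrt (real n) * (ln (real n) / 2) / 8 \<le> (real m + 1) * sieve_product m / 8"
      using m Pm ln_pos by (intro divide_right_mono mult_mono) auto
    also have "\<dots> \<le> real g"
      using sieve_number_minus_1_ge[of m] by (simp add: g_def real_sieve_number_minus_1)
    finally have g_ge: "sqrt (real n) * ln (real n) / 16 \<le> real g" by simp
    \<comment> \<open>Here \<open>j * g * sieve_product m\<close> is \<open>O(n log n)\<close> while
      \<open>g * sieve_product m\<close> is at least of order \<open>sqrt n * (log n)^2\<close>, so
      \<open>j\<close> is \<open>O(sqrt n / log n)\<close>.\<close>
    have "real j * (sqrt (real n) * (ln (real n))\<^sup>2)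
        = 32 * (real j * (sqrt (real n) * ln (real n) / 16) * (ln (real n) / 2))"
      by (simp add: power2_eq_square)
    also have "\<dots> \<le> 32 * (real j * real g * sieve_product m)"
      using g_ge Pm ln_pos by (intro mult_left_mono mult_mono) auto
    also have "\<dots> \<le> 32 * (real b * sieve_product (Suc m))"
    proof -
      have "real j * real g \<le> real b"
        using real_div_bounds(1)[OF b g(2)] g(2) by (simp add: j_def field_simps)
      then show ?thesis
        using sieve_product_mono[of m "Suc m"] sieve_product_ge_1[of m]
        by (intro mult_left_mono mult_mono) auto
    qed
    also have "\<dots> \<le> 32 * ((real n + 2) * sieve_product (Suc n))"
      using sieve_rank_mult_sieve_product_le[of "Suc n" "Suc m"] \<open>m \<le> n\<close> by (simp add: b_def add_ac)
    also have "\<dots> \<le> 32 * (real n + 2) * (2 + 8 * ln (real n + 1))"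
      using Pn by (simp only: mult.assoc) (intro mult_left_mono; simp)
    also have "\<dots> \<le> (sqrt (real n) - 1) * (sqrt (real n) * (ln (real n))\<^sup>2)" by (rule elim(1))
    finally have j_le: "real j \<le> sqrt (real n) - 1"
      using ln_pos elim(3) by (simp add: mult_le_cancel_right)
    with m g have "j + 1 \<le> g" by linarith
    then have "gap_controlled (sieve_rank (Suc m) (sieve_number n)) b g"
      unfolding b_def g_def using elim(3) \<open>m \<le> n\<close>
      by (intro gap_controlled_sieve_rank) (auto simp: b_def g_def j_def)
    then have "b \<le> sieve_rank (Suc m) (sieve_number n) + j + 1"
      unfolding gap_controlled_def j_def by linarith
    \<comment> \<open>The difference contributes \<open>j + 1 \<le> sqrt n\<close>, the rounding
      errors \<open>m + 1 \<le> sqrt n + 1\<close>.\<close>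
    then have d: "real b - real (sieve_rank (Suc m) (sieve_number n)) + real (Suc m) \<le> 2 * sqrt (real n) + 1"
      using j_le m by linarith
    have "real (sieve_number (Suc n)) - real (sieve_number n)
        \<le> sieve_product (Suc m) * (real b - real (sieve_rank (Suc m) (sieve_number n)) + real (Suc m))"
      unfolding b_def using elim(3) by (intro sieve_number_gap_le) simp
    also have "\<dots> \<le> sieve_product (Suc m) * (2 * sqrt (real n) + 1)"
      using d sieve_product_ge_1[of "Suc m"] by (intro mult_left_mono) auto
    also have "\<dots> \<le> (2 + 8 * ln (real n + 1)) * (2 * sqrt (real n) + 1)"
      using sieve_product_mono[of "Suc m" "Suc n"] \<open>m \<le> n\<close> Pn by (intro mult_right_mono) auto
    also have "\<dots> \<le> 20 * (sqrt (real n) * ln (real n))" by (rule elim(2))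
    finally show ?case .
  qed
qed

theorem theorem5p1:
  shows "(\<exists>C::real. C > 0 \<and> (\<exists>n0::nat. \<forall>n\<ge>n0.
            real (lucky (n + 1)) - real (lucky n)
              \<le> C * sqrt (real (lucky n) * ln (real (lucky n)))))
       \<and> (\<exists>C'::real. C' > 0 \<and> (\<exists>n0'::nat. \<forall>n\<ge>n0'.
            real (lucky (n + 1)) - real (lucky n)
              \<le> C' * (sqrt (real n) * ln (real n))))"
proof -
  obtain N where N: "\<And>n. N \<le> n \<Longrightarrow>
      real (sieve_number (Suc n)) - real (sieve_number n) \<le> 20 * (sqrt (real n) * ln (real n))"
    using sieve_number_gap_eventually unfolding eventually_sequentially by blast
  have gap: "real (lucky (n + 1)) - real (lucky n) \<le> 20 * (sqrt (real n) * ln (real n))"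
    if n: "N + 2 \<le> n" for n
  proof -
    obtain k where k: "n = Suc k" "N \<le> k" "1 \<le> k" using n by (cases n) auto
    have "sqrt (real k) * ln (real k) \<le> sqrt (real n) * ln (real n)"
      using k by (intro mult_mono) auto
    with N[OF k(2)] show ?thesis by (simp add: lucky_eq_sieve_number k(1))
  qed
  \<comment> \<open>From \<open>lucky n \<ge> n * ln n / 4\<close> and
    \<open>ln (lucky n) \<ge> ln n\<close>; the root of 4 turns the constant 20 into 40.\<close>
  have lower: "sqrt (real n) * ln (real n) \<le> 2 * sqrt (real (lucky n) * ln (real (lucky n)))"
    if n: "2 \<le> n" for n
  proof -
    obtain k where k: "n = Suc k" "1 \<le> k" using n by (cases n) auto
    have l: "lucky n = sieve_number k" by (simp add: lucky_eq_sieve_number k(1))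
    have "real n * ln (real n) / 4 \<le> real n * sieve_product k / 4"
      using ln_le_sieve_product[of k] k by (simp add: add_ac mult_left_mono)
    also have "\<dots> \<le> real (lucky n)"
      using sieve_number_ge_sieve_product[OF k(2)] unfolding l by (simp add: k(1) add_ac)
    finally have "real n * ln (real n) / 4 \<le> real (lucky n)" .
    moreover have "ln (real n) \<le> ln (real (lucky n))"
      unfolding l using sieve_number_ge[of k] by (intro ln_mono) (auto simp: k(1))
    ultimately have "real n * ln (real n) / 4 * ln (real n) \<le> real (lucky n) * ln (real (lucky n))"
      using n by (intro mult_mono) auto
    then have "real n * (ln (real n))\<^sup>2 \<le> 4 * (real (lucky n) * ln (real (lucky n)))"
      by (simp add: power2_eq_square)
    then have "sqrt (real n * (ln (real n))\<^sup>2) \<le> sqrt (4 * (real (lucky n) * ln (real (lucky n))))"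
      by (rule real_sqrt_le_mono)
    then show ?thesis using n by (simp add: real_sqrt_mult)
  qed
  have "real (lucky (n + 1)) - real (lucky n) \<le> 40 * sqrt (real (lucky n) * ln (real (lucky n)))"
    if "N + 2 \<le> n" for n
    using gap[OF that] lower[of n] that by linarith
  then have "\<exists>C::real. C > 0 \<and> (\<exists>n0::nat. \<forall>n\<ge>n0.
      real (lucky (n + 1)) - real (lucky n) \<le> C * sqrt (real (lucky n) * ln (real (lucky n))))"
    by (intro exI[of _ 40] conjI exI[of _ "N + 2"]) auto
  moreover have "\<exists>C'::real. C' > 0 \<and> (\<exists>n0'::nat. \<forall>n\<ge>n0'.
      real (lucky (n + 1)) - real (lucky n) \<le> C' * (sqrt (real n) * ln (real n)))"
    using gap by (intro exI[of _ 20] conjI exI[of _ "N + 2"]) auto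
  ultimately show ?thesis by blast
qed

end
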